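(* Let $(B_0,B_1)$ be an interpolation couple of complex Banach spaces, let $0<\theta<1$ and let $1<p<+\infty$. Assume that the norm on $B_0$ is uniformly rotund. Then the real interpolation space $B_{\theta,p}=(B_0,B_1)_{\theta,p}$ admits an equivalent uniformly rotund norm.
   Context: An interpolation couple $(B_0,B_1)$ is a pair of complex Banach spaces continuously embedded in a common Hausdorff topological vector space. Real interpolation space: for $a\in B_0+B_1$ and $t>0$ let $K(t,a)=\inf\{\|a_0\|_{B_0}+t\|a_1\|_{B_1}: a=a_0+a_1,\ a_j\in B_j\}$. Then $B_{\theta,p}=\{a\in B_0+B_1: \|a\|_{B_{\theta,p}}=\left[\int_0^\infty (t^{-\theta}K(t,a))^p\frac{dt}{t}\right]^{1/p}<+\infty\}$, a Banach space with this norm. A norm $\|\cdot\|$ on a Banach space $X$ is uniformly rotund (UR) if $\|x_n-y_n\|\to 0$ whenever $(x_n),(y_n)$ are sequences in the unit sphere of $X$ with $\lim_{n}\|x_n+y_n\|=2$. *)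

theory Defs
  imports "HOL-Analysis.Analysis"
begin

text \<open>
  The library has no class of complex normed spaces, and real interpolation spaces are subspaces
  of the ambient space of the couple.  All Banach spaces are therefore given by a carrier
  \<open>X\<close> inside an ambient complex vector space \<open>'v\<close> with scalar multiplication
  \<open>smul\<close>, and a function \<open>N\<close> that is a norm on \<open>X\<close>; the values of
  \<open>N\<close> outside \<open>X\<close> are irrelevant.
\<close>

text \<open>The Hausdorff property and the continuity of addition come from the sort of \<open>'v\<close>.\<close>

definition hausdorff_complex_tvs ::
    "(complex \<Rightarrow> 'v \<Rightarrow> 'v::{topological_ab_group_add, t2_space}) \<Rightarrow> bool" where
  "hausdorff_complex_tvs smul \<longleftrightarrow>
     vector_space smul \<and> continuous_on UNIV (\<lambda>(c, x). smul c x)"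

definition norm_on ::
    "(complex \<Rightarrow> 'v \<Rightarrow> 'v::ab_group_add) \<Rightarrow> 'v set \<Rightarrow> ('v \<Rightarrow> real) \<Rightarrow> bool" where
  "norm_on smul X N \<longleftrightarrow>
     module.subspace smul X \<and>
     (\<forall>x\<in>X. 0 \<le> N x) \<and>
     (\<forall>x\<in>X. N x = 0 \<longleftrightarrow> x = 0) \<and>
     (\<forall>c. \<forall>x\<in>X. N (smul c x) = cmod c * N x) \<and>
     (\<forall>x\<in>X. \<forall>y\<in>X. N (x + y) \<le> N x + N y)"

text \<open>
  The locale \<open>Metric_space\<close> asks for a distance that is nonnegative and symmetric on the whole
  type, hence the value 0 off the carrier.
\<close>

definition norm_dist :: "'v::ab_group_add set \<Rightarrow> ('v \<Rightarrow> real) \<Rightarrow> 'v \<Rightarrow> 'v \<Rightarrow> real" where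
  "norm_dist X N x y = (if x \<in> X \<and> y \<in> X then N (x - y) else 0)"

lemma Metric_space_norm_dist:
  assumes "vector_space smul" and "norm_on smul X N"
  shows "Metric_space X (norm_dist X N)"
proof -
  interpret vector_space smul by fact
  have sub: "subspace X" and nn: "\<And>x. x \<in> X \<Longrightarrow> 0 \<le> N x"
    and z: "\<And>x. x \<in> X \<Longrightarrow> N x = 0 \<longleftrightarrow> x = 0"
    and h: "\<And>c x. x \<in> X \<Longrightarrow> N (smul c x) = cmod c * N x"
    and tri: "\<And>x y. x \<in> X \<Longrightarrow> y \<in> X \<Longrightarrow> N (x + y) \<le> N x + N y"
    using assms(2) unfolding norm_on_def by auto
  have d: "x - y \<in> X" if "x \<in> X" "y \<in> X" for x y
    using subspace_diff[OF sub that] .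
  have c: "N (x - y) = N (y - x)" if "x \<in> X" "y \<in> X" for x y
    using h[OF d[OF that], of "-1"] by simp
  have t: "N (x - w) \<le> N (x - y) + N (y - w)" if "x \<in> X" "y \<in> X" "w \<in> X" for x y w
    using tri[OF d[OF that(1,2)] d[OF that(2,3)]] by simp
  show ?thesis
    by unfold_locales (auto simp: norm_dist_def nn z d c t)
qed

definition banach_on ::
    "(complex \<Rightarrow> 'v \<Rightarrow> 'v::ab_group_add) \<Rightarrow> 'v set \<Rightarrow> ('v \<Rightarrow> real) \<Rightarrow> bool" where
  "banach_on smul X N \<longleftrightarrow>
     norm_on smul X N \<and> Metric_space.mcomplete X (norm_dist X N)"

definition continuously_embedded ::
    "'v::{ab_group_add, topological_space} set \<Rightarrow> ('v \<Rightarrow> real) \<Rightarrow> bool" where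
  "continuously_embedded X N \<longleftrightarrow>
     continuous_map (Metric_space.mtopology X (norm_dist X N)) euclidean (\<lambda>x. x)"

definition interpolation_couple ::
    "(complex \<Rightarrow> 'v \<Rightarrow> 'v::{topological_ab_group_add, t2_space}) \<Rightarrow>
     'v set \<Rightarrow> ('v \<Rightarrow> real) \<Rightarrow> 'v set \<Rightarrow> ('v \<Rightarrow> real) \<Rightarrow> bool" where
  "interpolation_couple smul B0 N0 B1 N1 \<longleftrightarrow>
     hausdorff_complex_tvs smul \<and>
     banach_on smul B0 N0 \<and> continuously_embedded B0 N0 \<and>
     banach_on smul B1 N1 \<and> continuously_embedded B1 N1"

definition K_functional ::
    "'v::ab_group_add set \<Rightarrow> ('v \<Rightarrow> real) \<Rightarrow> 'v set \<Rightarrow> ('v \<Rightarrow> real) \<Rightarrow> real \<Rightarrow> 'v \<Rightarrow> real" where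
  "K_functional B0 N0 B1 N1 t a =
     Inf {N0 a0 + t * N1 a1 | a0 a1. a0 \<in> B0 \<and> a1 \<in> B1 \<and> a = a0 + a1}"

definition interp_integral ::
    "'v::ab_group_add set \<Rightarrow> ('v \<Rightarrow> real) \<Rightarrow> 'v set \<Rightarrow> ('v \<Rightarrow> real) \<Rightarrow>
     real \<Rightarrow> real \<Rightarrow> 'v \<Rightarrow> ennreal" where
  "interp_integral B0 N0 B1 N1 \<theta> p a =
     (\<integral>\<^sup>+t\<in>{0<..}. ennreal ((t powr (-\<theta>) * K_functional B0 N0 B1 N1 t a) powr p / t) \<partial>lborel)"

definition interp_space ::
    "'v::ab_group_add set \<Rightarrow> ('v \<Rightarrow> real) \<Rightarrow> 'v set \<Rightarrow> ('v \<Rightarrow> real) \<Rightarrow>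
     real \<Rightarrow> real \<Rightarrow> 'v set" where
  "interp_space B0 N0 B1 N1 \<theta> p =
     {a. (\<exists>a0\<in>B0. \<exists>a1\<in>B1. a = a0 + a1) \<and> interp_integral B0 N0 B1 N1 \<theta> p a < \<infinity>}"

definition interp_norm ::
    "'v::ab_group_add set \<Rightarrow> ('v \<Rightarrow> real) \<Rightarrow> 'v set \<Rightarrow> ('v \<Rightarrow> real) \<Rightarrow>
     real \<Rightarrow> real \<Rightarrow> 'v \<Rightarrow> real" where
  "interp_norm B0 N0 B1 N1 \<theta> p a = enn2real (interp_integral B0 N0 B1 N1 \<theta> p a) powr (1 / p)"

definition equivalent_on :: "'v set \<Rightarrow> ('v \<Rightarrow> real) \<Rightarrow> ('v \<Rightarrow> real) \<Rightarrow> bool" where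
  "equivalent_on X N M \<longleftrightarrow>
     (\<exists>c>0. \<exists>C>0. \<forall>x\<in>X. c * N x \<le> M x \<and> M x \<le> C * N x)"

definition uniformly_rotund :: "'v::ab_group_add set \<Rightarrow> ('v \<Rightarrow> real) \<Rightarrow> bool" where
  "uniformly_rotund X N \<longleftrightarrow>
     (\<forall>x y :: nat \<Rightarrow> 'v.
        (\<forall>n. x n \<in> X \<and> N (x n) = 1) \<and> (\<forall>n. y n \<in> X \<and> N (y n) = 1) \<and>
        (\<lambda>n. N (x n + y n)) \<longlonglongrightarrow> 2 \<longrightarrow>
        (\<lambda>n. N (x n - y n)) \<longlonglongrightarrow> 0)"

end

theory Submission imports Defs begin

text \<open>
  Replacing \<open>K(t,a)\<^sup>p\<close> by the comparable
  \<open>Kp(t,a) = inf {\<parallel>x\<parallel>\<^sub>0\<^sup>p + (t \<parallel>y\<parallel>\<^sub>1)\<^sup>p | a = x + y}\<close> gives the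
  functional \<open>F(a) = \<integral> t\<^sup>-\<^sup>\<theta>\<^sup>p Kp(t,a) dt/t\<close>, which is convex and
  \<open>p\<close>-homogeneous, so \<open>F\<^sup>1\<^sup>/\<^sup>p\<close> is an equivalent norm.  Uniform rotundity of the norm
  on \<open>B0\<close> means that for each \<open>\<epsilon> > 0\<close> some \<open>C\<close> satisfies
  \<open>\<parallel>x - y\<parallel>\<^sub>0\<^sup>p \<le> \<epsilon> (\<parallel>x\<parallel>\<^sub>0\<^sup>p + \<parallel>y\<parallel>\<^sub>0\<^sup>p)
    + C ((\<parallel>x\<parallel>\<^sub>0\<^sup>p + \<parallel>y\<parallel>\<^sub>0\<^sup>p) / 2 - \<parallel>(x + y) / 2\<parallel>\<^sub>0\<^sup>p)\<close>.
  Apply this to near-optimal decompositions of \<open>a\<close> and \<open>b\<close> at \<open>t\<close>, and use the difference of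
  these decompositions for \<open>a - b\<close> at \<open>t / r\<close>.  Integration in \<open>t\<close> turns the rescaling by \<open>r\<close>
  into a factor \<open>r\<^sup>\<theta>\<^sup>p\<close>, whereas the \<open>B1\<close>-part carries \<open>r\<^sup>-\<^sup>p\<close>.  As \<open>\<theta> < 1\<close>, taking \<open>r\<close>
  large and then \<open>\<epsilon>\<close> small yields the same kind of inequality for \<open>F\<close>.
\<close>

section \<open>Elementary inequalities for real powers\<close>

lemma powr_convex_comb:
  fixes x y s p :: real
  assumes "1 \<le> p" "0 \<le> x" "0 \<le> y" "0 \<le> s" "s \<le> 1"
  shows "(s * x + (1 - s) * y) powr p \<le> s * x powr p + (1 - s) * y powr p"
proof -
  have small: "u powr p \<le> u" if "0 \<le> u" "u \<le> 1" for u :: real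
    using powr_mono'[of 1 p u] that assms(1) by simp
  \<comment> \<open>If an argument is 0, the claim reduces to \<open>u powr p \<le> u\<close> on the
    unit interval; otherwise it is the convexity of the power function.\<close>
  show ?thesis
  proof (cases "x = 0 \<or> y = 0")
    case True
    then show ?thesis
      using small[of s] small[of "1 - s"] assms
      by (auto simp: powr_mult intro!: mult_right_mono)
  next
    case False
    then show ?thesis
      using convex_onD[OF powr_convex[OF assms(1)], of s y x] assms
      by (simp add: add.commute)
  qed
qed

text \<open>Write \<open>u powr p\<close> as \<open>u * u powr (p - 1)\<close> and enlarge the
  second factor of each term to \<open>(x + y) powr (p - 1)\<close>.\<close>

lemma powr_add_superadditive:
  fixes x y p :: real
  assumes "1 \<le> p" "0 \<le> x" "0 \<le> y"
  shows "x powr p + y powr p \<le> (x + y) powr p"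
proof -
  have split: "u powr p = u * u powr (p - 1)" if "0 \<le> u" for u :: real
    using powr_mult_base[OF that, of "p - 1"] by simp
  have "x * x powr (p - 1) + y * y powr (p - 1) \<le> x * (x + y) powr (p - 1) + y * (x + y) powr (p - 1)"
    using assms by (intro add_mono mult_left_mono powr_mono2) auto
  then show ?thesis
    using assms by (simp add: split distrib_right)
qed

lemma powr_add_le:
  fixes x y p :: real
  assumes "1 \<le> p" "0 \<le> x" "0 \<le> y"
  shows "(x + y) powr p \<le> 2 powr p * (x powr p + y powr p)"
proof -
  have "(x + y) powr p \<le> (2 * max x y) powr p"
    using assms by (intro powr_mono2) auto
  also have "\<dots> = 2 powr p * max x y powr p"
    by (simp add: powr_mult)
  also have "\<dots> \<le> 2 powr p * (x powr p + y powr p)"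
    by (intro mult_left_mono) (auto simp: max_def)
  finally show ?thesis .
qed

text \<open>The derivative is \<open>p / 2 * (x powr (p - 1) - ((1 + x) / 2) powr (p - 1))\<close>,
  which is negative because \<open>x < (1 + x) / 2\<close> for \<open>x < 1\<close>. As the function
  vanishes at 1, a small value forces the argument to be close to 1.\<close>

lemma powr_midpoint_defect_antimono:
  fixes r s p :: real
  assumes "1 < p" "0 \<le> r" "r < s" "s \<le> 1"
  shows "(1 + s powr p) / 2 - ((1 + s) / 2) powr p < (1 + r powr p) / 2 - ((1 + r) / 2) powr p"
proof (rule DERIV_neg_imp_decreasing_open[OF \<open>r < s\<close>])
  fix x assume x: "r < x" "x < s"
  have "((\<lambda>x. (1 + x powr p) / 2 - ((1 + x) / 2) powr p) has_real_derivative
      (p * x powr (p - 1) / 2 - p * ((1 + x) / 2) powr (p - 1) / 2)) (at x)"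
    using x assms by (auto intro!: derivative_eq_intros simp: powr_diff field_simps)
  moreover have "x powr (p - 1) < ((1 + x) / 2) powr (p - 1)"
    using x assms by (intro powr_less_mono2) auto
  ultimately show "\<exists>y. ((\<lambda>x. (1 + x powr p) / 2 - ((1 + x) / 2) powr p) has_real_derivative y) (at x) \<and> y < 0"
    using assms by (intro exI conjI) auto
next
  show "continuous_on {r..s} (\<lambda>x. (1 + x powr p) / 2 - ((1 + x) / 2) powr p)"
    using assms by (intro continuous_intros continuous_on_powr') auto
qed

text \<open>Functionals defined by infima are measurable in \<open>t\<close> because they are
  monotone. Extending \<open>f\<close> by \<open>f 0\<close> to the negative axis makes it monotone
  on the whole line, and the indicator hides the change.\<close>

lemma weighted_mono_measurable:
  fixes f :: "real \<Rightarrow> real"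
  assumes "\<And>s t. 0 \<le> s \<Longrightarrow> s \<le> t \<Longrightarrow> f s \<le> f t"
  shows "(\<lambda>t. indicator {0<..} t * (t powr r * f t)) \<in> borel_measurable lborel"
proof -
  have "mono (\<lambda>t. f (max t 0))"
    using assms by (intro monoI) auto
  then have [measurable]: "(\<lambda>t. f (max t 0)) \<in> borel_measurable borel"
    by (rule borel_measurable_mono)
  have "(\<lambda>t. indicator {0<..} t * (t powr r * f t))
      = (\<lambda>t. indicator {0<..} t * (t powr r * f (max t 0)))"
    by (auto simp: fun_eq_iff indicator_def)
  then show ?thesis by simp
qed

section \<open>Uniform rotundity in terms of powers of the norm\<close>

locale complex_normed = vector_space smul
  for smul :: "complex \<Rightarrow> 'v \<Rightarrow> 'v::ab_group_add" +
  fixes X :: "'v set" and N :: "'v \<Rightarrow> real"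
  assumes norm_on: "norm_on smul X N"
begin

lemma sub: "subspace X"
  using norm_on by (simp add: norm_on_def)

lemma nonneg: "x \<in> X \<Longrightarrow> 0 \<le> N x"
  using norm_on by (simp add: norm_on_def)

lemma eq_0_iff: "x \<in> X \<Longrightarrow> N x = 0 \<longleftrightarrow> x = 0"
  using norm_on by (simp add: norm_on_def)

lemma N_scale: "x \<in> X \<Longrightarrow> N (smul c x) = cmod c * N x"
  using norm_on by (simp add: norm_on_def)

lemma triangle: "x \<in> X \<Longrightarrow> y \<in> X \<Longrightarrow> N (x + y) \<le> N x + N y"
  using norm_on by (simp add: norm_on_def)

lemma N_zero [simp]: "N 0 = 0"
  using eq_0_iff[of 0] subspace_0[OF sub] by simp

lemma N_minus: "x \<in> X \<Longrightarrow> N (- x) = N x"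
  using N_scale[of x "-1"] by simp

lemma N_diff_commute: "x \<in> X \<Longrightarrow> y \<in> X \<Longrightarrow> N (x - y) = N (y - x)"
  using N_minus[OF subspace_diff[OF sub, of x y]] by simp

lemma triangle_diff: "x \<in> X \<Longrightarrow> y \<in> X \<Longrightarrow> N (x - y) \<le> N x + N y"
  using triangle[of x "- y"] N_minus[of y] subspace_neg[OF sub, of y] by simp

lemma powr_convex_comb_le:
  assumes "x \<in> X" "y \<in> X" "0 \<le> s" "s \<le> 1" "1 \<le> p"
  shows "N (smul (of_real s) x + smul (of_real (1 - s)) y) powr p \<le> s * N x powr p + (1 - s) * N y powr p"
proof -
  have "N (smul (of_real s) x) = s * N x" "N (smul (of_real (1 - s)) y) = (1 - s) * N y"
    using assms by (simp_all add: N_scale del: of_real_diff)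
  then have "N (smul (of_real s) x + smul (of_real (1 - s)) y) \<le> s * N x + (1 - s) * N y"
    using triangle[of "smul (of_real s) x" "smul (of_real (1 - s)) y"] assms
    by (simp add: subspace_scale[OF sub] del: of_real_diff)
  then have "N (smul (of_real s) x + smul (of_real (1 - s)) y) powr p \<le> (s * N x + (1 - s) * N y) powr p"
    using assms by (intro powr_mono2 nonneg subspace_add[OF sub] subspace_scale[OF sub]) auto
  also have "\<dots> \<le> s * N x powr p + (1 - s) * N y powr p"
    using assms nonneg by (intro powr_convex_comb) auto
  finally show ?thesis .
qed

text \<open>This is the Jensen gap of the convex function \<open>N x powr p\<close> at a midpoint;
  it measures how far a segment is from being flat.\<close>

definition midpoint_defect :: "real \<Rightarrow> 'v \<Rightarrow> 'v \<Rightarrow> real" where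
  "midpoint_defect p x y = (N x powr p + N y powr p) / 2 - N (smul (1/2) (x + y)) powr p"

lemma midpoint_defect_scale:
  assumes "x \<in> X" "y \<in> X"
  shows "midpoint_defect p (smul c x) (smul c y) = cmod c powr p * midpoint_defect p x y"
proof -
  have "smul (1/2) (smul c x + smul c y) = smul c (smul (1/2) (x + y))"
    by (simp add: scale_right_distrib mult.commute)
  then have "N (smul (1/2) (smul c x + smul c y)) = cmod c * N (smul (1/2) (x + y))"
    using assms by (simp only: N_scale subspace_scale[OF sub] subspace_add[OF sub])
  then show ?thesis
    using assms by (simp only: midpoint_defect_def N_scale powr_mult) (simp add: algebra_simps)
qed

lemma midpoint_defect_commute: "midpoint_defect p x y = midpoint_defect p y x"
  by (simp add: midpoint_defect_def add.commute)

lemma norm_half_add: "x \<in> X \<Longrightarrow> y \<in> X \<Longrightarrow> N (smul (1/2) (x + y)) = N (x + y) / 2"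
  by (simp add: N_scale subspace_add[OF sub])

lemma midpoint_defect_nonneg:
  assumes "x \<in> X" "y \<in> X" "1 \<le> p"
  shows "0 \<le> midpoint_defect p x y"
  using powr_convex_comb_le[OF assms(1,2), of "1/2" p] assms
  by (simp add: midpoint_defect_def scale_right_distrib)

text \<open>By the triangle inequality the defect dominates that of the numbers 1 and
  \<open>N (y n)\<close>, so \<open>N (y n)\<close> tends to 1. Then \<open>y n\<close> can be
  replaced by a unit vector \<open>z n\<close> at vanishing cost, and rotundity applies to
  \<open>x n\<close> and \<open>z n\<close>.\<close>

lemma uniformly_rotund_defect_limit:
  assumes ur: "uniformly_rotund X N" and p: "1 < p"
    and X: "\<And>n. x n \<in> X" "\<And>n. y n \<in> X" and x1: "\<And>n. N (x n) = 1" and y1: "\<And>n. N (y n) \<le> 1"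
    and lim: "(\<lambda>n. midpoint_defect p (x n) (y n)) \<longlonglongrightarrow> 0"
  shows "(\<lambda>n. N (x n - y n)) \<longlonglongrightarrow> 0"
proof -
  let ?h = "\<lambda>r::real. (1 + r powr p) / 2 - ((1 + r) / 2) powr p"
  define r where "r n = N (y n)" for n
  have r01: "0 \<le> r n" "r n \<le> 1" for n
    using nonneg[OF X(2)] y1 by (auto simp: r_def)
  have h_le: "?h (r n) \<le> midpoint_defect p (x n) (y n)" for n
  proof -
    have "N (x n + y n) / 2 \<le> (1 + r n) / 2"
      using triangle[OF X, of n n] by (simp add: x1 r_def)
    then have "(N (x n + y n) / 2) powr p \<le> ((1 + r n) / 2) powr p"
      using p nonneg[OF subspace_add[OF sub X]] by (intro powr_mono2) auto
    then show ?thesis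
      by (simp add: midpoint_defect_def norm_half_add X x1 r_def)
  qed
  have r_lim: "r \<longlonglongrightarrow> 1"
  proof (rule order_tendstoI)
    fix a :: real assume a: "a < 1"
    \<comment> \<open>The monotonicity of \<open>?h\<close> is known only for nonnegative arguments,
      whereas \<open>a\<close> may be negative.\<close>
    define b where "b = max a 0"
    have b: "0 \<le> b" "b < 1"
      using a by (auto simp: b_def)
    have "0 < ?h b"
      using powr_midpoint_defect_antimono[OF p, of b 1] b by simp
    then have "\<forall>\<^sub>F n in sequentially. midpoint_defect p (x n) (y n) < ?h b"
      using order_tendstoD(2)[OF lim] by blast
    then show "\<forall>\<^sub>F n in sequentially. a < r n"
    proof eventually_elim
      case (elim n)
      show ?case
      proof (rule ccontr)
        assume "\<not> a < r n"
        then have "r n \<le> b" by (simp add: b_def)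
        then have "?h b \<le> ?h (r n)"
          using powr_midpoint_defect_antimono[OF p, of "r n" b] r01[of n] b
          by (cases "r n = b") auto
        with elim h_le[of n] show False by simp
      qed
    qed
  qed (use r01 in \<open>auto intro!: always_eventually intro: le_less_trans\<close>)
  \<comment> \<open>Rotundity asks for unit vectors at every index, so \<open>x n\<close> serves as
    a substitute when \<open>y n = 0\<close>. Eventually \<open>r n\<close> is positive and
    \<open>z n\<close> is \<open>y n\<close> normalised.\<close>
  define z where "z n = (if r n = 0 then x n else smul (of_real (1 / r n)) (y n))" for n
  have zX: "z n \<in> X" and z1: "N (z n) = 1" for n
    using X x1 r01[of n] by (auto simp: z_def N_scale r_def subspace_scale[OF sub] norm_divide)
  have zy: "\<forall>\<^sub>F n in sequentially. N (z n - y n) = 1 - r n"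
  proof -
    have "\<forall>\<^sub>F n in sequentially. 0 < r n"
      using order_tendstoD(1)[OF r_lim] by simp
    then show ?thesis
    proof eventually_elim
      case (elim n)
      have "y n = smul (of_real (r n)) (z n)"
        using elim by (simp add: z_def)
      then have "z n - y n = smul (of_real (1 - r n)) (z n)"
        using scale_left_diff_distrib[of 1 "of_real (r n)" "z n"] by simp
      then have "N (z n - y n) = cmod (of_real (1 - r n))"
        using N_scale[OF zX] z1 by simp
      then show ?case
        using r01[of n] by (simp only: norm_of_real)
    qed
  qed
  have zy_lim: "(\<lambda>n. N (z n - y n)) \<longlonglongrightarrow> 0"
    using zy tendsto_diff[OF tendsto_const[of 1] r_lim]
    by (subst tendsto_cong[OF zy]) auto
  \<comment> \<open>Solving the definition of the defect for \<open>N (x n + y n) / 2\<close>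
    expresses it through quantities with known limits.\<close>
  have "(\<lambda>n. ((1 + r n powr p) / 2 - midpoint_defect p (x n) (y n)) powr (1 / p)) \<longlonglongrightarrow> ((1 + 1 powr p) / 2 - 0) powr (1 / p)"
    using p by (intro tendsto_intros r_lim lim) auto
  moreover have "((1 + r n powr p) / 2 - midpoint_defect p (x n) (y n)) powr (1 / p) = N (x n + y n) / 2" for n
    using p nonneg[OF subspace_add[OF sub X], of n n]
    by (simp add: midpoint_defect_def x1 r_def norm_half_add X powr_powr)
  ultimately have "(\<lambda>n. N (x n + y n) / 2) \<longlonglongrightarrow> 1" by simp
  from tendsto_mult_right[OF this, of 2] have xy_lim: "(\<lambda>n. N (x n + y n)) \<longlonglongrightarrow> 2" by simp
  have "(\<lambda>n. N (x n + z n)) \<longlonglongrightarrow> 2"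
  proof (rule tendsto_sandwich[OF _ _ _ tendsto_const])
    show "\<forall>\<^sub>F n in sequentially. N (x n + y n) - N (z n - y n) \<le> N (x n + z n)"
    proof (intro always_eventually allI)
      fix n
      have "N ((x n + z n) - (z n - y n)) \<le> N (x n + z n) + N (z n - y n)"
        by (intro triangle_diff subspace_add[OF sub] subspace_diff[OF sub] X zX)
      then show "N (x n + y n) - N (z n - y n) \<le> N (x n + z n)" by simp
    qed
    show "(\<lambda>n. N (x n + y n) - N (z n - y n)) \<longlonglongrightarrow> 2"
      using tendsto_diff[OF xy_lim zy_lim] by simp
    show "\<forall>\<^sub>F n in sequentially. N (x n + z n) \<le> 2"
      using triangle[OF X(1) zX] by (auto intro!: always_eventually simp: x1 z1)
  qed
  then have xz_lim: "(\<lambda>n. N (x n - z n)) \<longlonglongrightarrow> 0"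
    using ur X zX x1 z1 unfolding uniformly_rotund_def by blast
  show ?thesis
  proof (rule tendsto_sandwich[OF _ _ tendsto_const])
    show "\<forall>\<^sub>F n in sequentially. N (x n - y n) \<le> N (x n - z n) + N (z n - y n)"
    proof (intro always_eventually allI)
      fix n
      have "N ((x n - z n) + (z n - y n)) \<le> N (x n - z n) + N (z n - y n)"
        by (intro triangle subspace_diff[OF sub] X zX)
      then show "N (x n - y n) \<le> N (x n - z n) + N (z n - y n)" by simp
    qed
    show "\<forall>\<^sub>F n in sequentially. 0 \<le> N (x n - y n)"
      using nonneg[OF subspace_diff[OF sub X]] by (auto intro: always_eventually)
    show "(\<lambda>n. N (x n - z n) + N (z n - y n)) \<longlonglongrightarrow> 0"
      using tendsto_add[OF xz_lim zy_lim] by simp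
  qed
qed

text \<open>Being linear in the powers of the norm, this form of uniform rotundity can be
  integrated.\<close>

lemma uniformly_rotund_powr_diff_le:
  assumes ur: "uniformly_rotund X N" and p: "1 < p" and \<epsilon>: "0 < \<epsilon>"
  obtains C where "0 \<le> C"
    "\<And>x y. x \<in> X \<Longrightarrow> y \<in> X \<Longrightarrow>
       N (x - y) powr p \<le> \<epsilon> * (N x powr p + N y powr p) + C * midpoint_defect p x y"
proof -
  let ?bad = "\<lambda>C x y. \<epsilon> * (N x powr p + N y powr p) + C * midpoint_defect p x y < N (x - y) powr p"
  \<comment> \<open>If no natural number served as \<open>C\<close>, the normalised counterexamples
    would form sequences whose defect tends to 0 while their differences stay bounded away from
    0.\<close>
  have "\<exists>n::nat. \<forall>x\<in>X. \<forall>y\<in>X. \<not> ?bad (real n) x y"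
  proof (rule ccontr)
    assume "\<not> ?thesis"
    then have bad: "\<exists>x\<in>X. \<exists>y\<in>X. ?bad (real n) x y" for n by auto
    have "\<exists>x y. x \<in> X \<and> y \<in> X \<and> N x = 1 \<and> N y \<le> 1 \<and> ?bad (real n) x y" for n
    proof -
      \<comment> \<open>The inequality is symmetric in the two vectors, so the one of larger norm
        may be called \<open>x\<close>.\<close>
      obtain x y where xy: "x \<in> X" "y \<in> X" "?bad (real n) x y" "N y \<le> N x"
      proof -
        obtain x y where xy: "x \<in> X" "y \<in> X" "?bad (real n) x y"
          using bad by blast
        show thesis
        proof (cases "N y \<le> N x")
          case True
          with xy that show thesis by blast
        next
          case False
          with xy that[of y x] show thesis
            by (simp add: N_diff_commute midpoint_defect_commute add.commute)
        qed
      qed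
      have "N x \<noteq> 0"
      proof
        assume "N x = 0"
        with xy nonneg[of y] have "x = 0" "y = 0" using eq_0_iff by auto
        with xy(3) show False by (simp add: midpoint_defect_def)
      qed
      then have pos: "0 < N x" using nonneg[OF xy(1)] by simp
      \<comment> \<open>All terms are homogeneous of degree \<open>p\<close>, so scaling by
        \<open>c\<close> makes \<open>N x\<close> equal to 1 and keeps the strict
        inequality.\<close>
      define c :: complex where "c = of_real (1 / N x)"
      have c: "cmod c = 1 / N x" using pos by (simp add: c_def norm_divide)
      have "cmod c powr p * (\<epsilon> * (N x powr p + N y powr p) + real n * midpoint_defect p x y)
          < cmod c powr p * N (x - y) powr p"
        using xy(3) pos by (intro mult_strict_left_mono) (auto simp: c)
      moreover have "N (smul c x - smul c y) = cmod c * N (x - y)"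
        using xy(1,2) by (simp add: N_scale subspace_diff[OF sub] flip: scale_right_diff_distrib)
      ultimately have "?bad (real n) (smul c x) (smul c y)"
        using xy(1,2)
        by (simp add: midpoint_defect_scale N_scale powr_mult algebra_simps)
      moreover have "N (smul c x) = 1" "N (smul c y) \<le> 1"
        using xy pos by (auto simp: N_scale c)
      ultimately show ?thesis
        using xy(1,2) subspace_scale[OF sub] by blast
    qed
    then obtain x y where X: "\<And>n. x n \<in> X" "\<And>n. y n \<in> X"
      and x1: "\<And>n. N (x n) = 1" and y1: "\<And>n. N (y n) \<le> 1" and b: "\<And>n. ?bad (real n) (x n) (y n)"
      by metis
    have diff_le: "N (x n - y n) powr p \<le> 2 powr p" for n
      using triangle_diff[OF X, of n n] x1[of n] y1[of n] p nonneg[OF subspace_diff[OF sub X], of n n]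
      by (intro powr_mono2) auto
    \<comment> \<open>The power of the difference is at most \<open>2 powr p\<close> and exceeds
      \<open>n\<close> times the defect.\<close>
    have "midpoint_defect p (x n) (y n) \<le> 2 powr p / real n" if "0 < n" for n
    proof -
      have "0 \<le> \<epsilon> * (N (x n) powr p + N (y n) powr p)" using \<epsilon> by simp
      then have "real n * midpoint_defect p (x n) (y n) \<le> 2 powr p"
        using b[of n] diff_le[of n] by linarith
      then show ?thesis using that by (simp add: field_simps)
    qed
    then have "(\<lambda>n. midpoint_defect p (x n) (y n)) \<longlonglongrightarrow> 0"
      using midpoint_defect_nonneg X p
      by (intro tendsto_sandwich[OF _ _ tendsto_const lim_const_over_n[of "2 powr p"]])
        (auto intro!: always_eventually eventually_sequentiallyI[of 1])
    then have "(\<lambda>n. N (x n - y n)) \<longlonglongrightarrow> 0"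
      by (rule uniformly_rotund_defect_limit[OF ur p X x1 y1])
    then have "(\<lambda>n. N (x n - y n) powr p) \<longlonglongrightarrow> 0 powr p"
      using p nonneg[OF subspace_diff[OF sub X]] by (intro tendsto_powr2 tendsto_const) auto
    then have "\<forall>\<^sub>F n in sequentially. N (x n - y n) powr p < \<epsilon>"
      using order_tendstoD(2)[of _ "0::real" sequentially \<epsilon>] \<epsilon> by simp
    then obtain n where n: "N (x n - y n) powr p < \<epsilon>"
      using eventually_happens[of _ sequentially] by auto
    have "0 \<le> real n * midpoint_defect p (x n) (y n)"
      using midpoint_defect_nonneg X p by simp
    moreover have "\<epsilon> \<le> \<epsilon> * (N (x n) powr p + N (y n) powr p)"
      using \<epsilon> x1 by simp
    ultimately show False using b[of n] n by linarith
  qed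
  then show thesis using that by (metis not_less of_nat_0_le_iff)
qed

end

section \<open>The interpolation couple and the functional \<open>Kp\<close>\<close>

text \<open>Limits taken in the two different norms of a couple are compared in the ambient
  topology.\<close>

lemma continuously_embedded_tendsto_zero:
  fixes x :: "nat \<Rightarrow> 'v::{ab_group_add, topological_space}"
  assumes "complex_normed smul X N" and emb: "continuously_embedded X N"
    and x: "\<And>n. x n \<in> X" and lim: "(\<lambda>n. N (x n)) \<longlonglongrightarrow> 0"
  shows "x \<longlonglongrightarrow> 0"
proof -
  interpret complex_normed smul X N by fact
  interpret M: Metric_space X "norm_dist X N"
    by (rule Metric_space_norm_dist[OF vector_space_axioms norm_on])
  have "limitin M.mtopology x 0 sequentially"
    unfolding M.limitin_metric
    using x nonneg order_tendstoD(2)[OF lim] subspace_0[OF sub] by (simp add: norm_dist_def)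
  then show ?thesis
    using continuous_map_limit[OF emb[unfolded continuously_embedded_def]] by (simp add: o_def)
qed

locale interpolation = A0: complex_normed smul B0 N0 + A1: complex_normed smul B1 N1
  for smul :: "complex \<Rightarrow> 'v \<Rightarrow> 'v::{topological_ab_group_add, t2_space}"
    and B0 N0 B1 N1 +
  fixes \<theta> p :: real
  assumes embedded0: "continuously_embedded B0 N0" and embedded1: "continuously_embedded B1 N1"
    and \<theta>: "0 < \<theta>" "\<theta> < 1" and p: "1 < p"
begin

definition sum_space :: "'v set" where
  "sum_space = {x + y | x y. x \<in> B0 \<and> y \<in> B1}"

definition Kp :: "real \<Rightarrow> 'v \<Rightarrow> real" where
  "Kp t a = Inf {N0 x powr p + (t * N1 y) powr p | x y. x \<in> B0 \<and> y \<in> B1 \<and> a = x + y}"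

lemma sum_space_subspace: "A0.subspace sum_space"
  unfolding sum_space_def by (rule A0.subspace_sums[OF A0.sub A1.sub])

lemmas sum_space_add = A0.subspace_add[OF sum_space_subspace]
lemmas sum_space_scale = A0.subspace_scale[OF sum_space_subspace]
lemmas zero_in_sum_space = A0.subspace_0[OF sum_space_subspace]

lemma Kp_le:
  assumes "x \<in> B0" "y \<in> B1"
  shows "Kp t (x + y) \<le> N0 x powr p + (t * N1 y) powr p"
  unfolding Kp_def using assms by (intro cInf_lower bdd_belowI[of _ 0]) auto

lemma le_Kp:
  assumes "a \<in> sum_space"
    and "\<And>x y. x \<in> B0 \<Longrightarrow> y \<in> B1 \<Longrightarrow> a = x + y \<Longrightarrow> c \<le> N0 x powr p + (t * N1 y) powr p"
  shows "c \<le> Kp t a"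
  unfolding Kp_def using assms by (intro cInf_greatest) (auto simp: sum_space_def)

lemma Kp_approx:
  assumes "a \<in> sum_space" "Kp t a < c"
  obtains x y where "x \<in> B0" "y \<in> B1" "a = x + y" "N0 x powr p + (t * N1 y) powr p < c"
  using le_Kp[of a c t] assms by fastforce

lemma Kp_nonneg: "a \<in> sum_space \<Longrightarrow> 0 \<le> Kp t a"
  by (rule le_Kp) auto

lemma Kp_mono:
  assumes "a \<in> sum_space" "0 \<le> s" "s \<le> t"
  shows "Kp s a \<le> Kp t a"
proof (rule le_Kp[OF assms(1)])
  fix x y assume xy: "x \<in> B0" "y \<in> B1" "a = x + y"
  have "(s * N1 y) powr p \<le> (t * N1 y) powr p"
    using assms p A1.nonneg[OF xy(2)] by (intro powr_mono2 mult_right_mono) auto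
  with Kp_le[OF xy(1,2), of s] xy(3) show "Kp s a \<le> N0 x powr p + (t * N1 y) powr p"
    by simp
qed

lemma Kp_scale_le:
  assumes "a \<in> sum_space"
  shows "Kp t (smul c a) \<le> cmod c powr p * Kp t a"
proof (cases "c = 0")
  case True
  then show ?thesis
    using Kp_le[of 0 0 t] A0.subspace_0[OF A0.sub] A0.subspace_0[OF A1.sub] by simp
next
  case False
  have "Kp t (smul c a) / cmod c powr p \<le> Kp t a"
  proof (rule le_Kp[OF assms])
    fix x y assume xy: "x \<in> B0" "y \<in> B1" "a = x + y"
    have "Kp t (smul c a) \<le> cmod c powr p * (N0 x powr p + (t * N1 y) powr p)"
      using Kp_le[of "smul c x" "smul c y" t] xy
      by (simp add: A0.subspace_scale[OF A0.sub] A0.subspace_scale[OF A1.sub] A0.N_scale A1.N_scale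
          A0.scale_right_distrib powr_mult algebra_simps)
    then show "Kp t (smul c a) / cmod c powr p \<le> N0 x powr p + (t * N1 y) powr p"
      using False by (simp add: field_simps)
  qed
  then show ?thesis using False by (simp add: field_simps)
qed

text \<open>The reverse of \<open>Kp_scale_le\<close> follows by applying it to
  \<open>smul c a\<close> and the scalar \<open>inverse c\<close>.\<close>

lemma Kp_scale:
  assumes "a \<in> sum_space"
  shows "Kp t (smul c a) = cmod c powr p * Kp t a"
proof (cases "c = 0")
  case True
  then show ?thesis
    using Kp_scale_le[OF assms, of t c] Kp_nonneg[OF zero_in_sum_space, of t] by simp
next
  case False
  have "Kp t (smul (inverse c) (smul c a)) \<le> cmod (inverse c) powr p * Kp t (smul c a)"
    by (intro Kp_scale_le sum_space_scale assms)
  then have "Kp t a \<le> inverse (cmod c powr p) * Kp t (smul c a)"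
    using False by (simp add: norm_inverse inverse_powr)
  then have "cmod c powr p * Kp t a \<le> Kp t (smul c a)"
    using False by (simp add: field_simps)
  with Kp_scale_le[OF assms, of t c] show ?thesis by simp
qed

text \<open>Combining near-optimal decompositions of \<open>a\<close> and \<open>b\<close> with the
  same weights decomposes the combination, and the \<open>p\<close>-th powers of both norms are
  convex. The two errors \<eta> average to \<eta>.\<close>

lemma Kp_convex_comb:
  assumes ab: "a \<in> sum_space" "b \<in> sum_space" and s: "0 \<le> s" "s \<le> 1" and t: "0 \<le> t"
  shows "Kp t (smul (of_real s) a + smul (of_real (1 - s)) b) \<le> s * Kp t a + (1 - s) * Kp t b"
proof (rule field_le_epsilon)
  fix \<eta> :: real assume "0 < \<eta>"
  then have "Kp t a < Kp t a + \<eta>" "Kp t b < Kp t b + \<eta>" by auto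
  obtain x y where xy: "x \<in> B0" "y \<in> B1" "a = x + y"
    "N0 x powr p + (t * N1 y) powr p < Kp t a + \<eta>"
    using Kp_approx[OF ab(1) \<open>Kp t a < Kp t a + \<eta>\<close>] .
  obtain x' y' where xy': "x' \<in> B0" "y' \<in> B1" "b = x' + y'"
    "N0 x' powr p + (t * N1 y') powr p < Kp t b + \<eta>"
    using Kp_approx[OF ab(2) \<open>Kp t b < Kp t b + \<eta>\<close>] .
  let ?x = "smul (of_real s) x + smul (of_real (1 - s)) x'"
  let ?y = "smul (of_real s) y + smul (of_real (1 - s)) y'"
  have in_B: "?x \<in> B0" "?y \<in> B1"
    using xy xy' by (auto intro!: A0.subspace_add A0.subspace_scale A0.sub A1.sub)
  have "Kp t (?x + ?y) \<le> N0 ?x powr p + t powr p * N1 ?y powr p"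
    using Kp_le[OF in_B, of t] by (simp add: powr_mult)
  also have "\<dots> \<le> (s * N0 x powr p + (1 - s) * N0 x' powr p)
      + t powr p * (s * N1 y powr p + (1 - s) * N1 y' powr p)"
    using xy xy' s p
    by (intro add_mono mult_left_mono A0.powr_convex_comb_le A1.powr_convex_comb_le) auto
  also have "\<dots> = s * (N0 x powr p + (t * N1 y) powr p) + (1 - s) * (N0 x' powr p + (t * N1 y') powr p)"
    by (simp add: powr_mult algebra_simps)
  also have "\<dots> \<le> s * (Kp t a + \<eta>) + (1 - s) * (Kp t b + \<eta>)"
    using xy xy' s by (intro add_mono[OF mult_left_mono mult_left_mono]) auto
  also have "\<dots> = s * Kp t a + (1 - s) * Kp t b + \<eta>"
    by (simp add: algebra_simps)
  finally show "Kp t (smul (of_real s) a + smul (of_real (1 - s)) b) \<le> s * Kp t a + (1 - s) * Kp t b + \<eta>"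
    unfolding xy(3) xy'(3) by (simp only: A0.scale_right_distrib ac_simps)
qed

text \<open>The \<open>B1\<close>-part of the decomposition of \<open>a - b\<close> is only bounded; measuring
  \<open>a - b\<close> at the smaller parameter \<open>t / r\<close> makes its contribution small.\<close>

lemma Kp_diff_le:
  assumes C: "0 \<le> C" and \<epsilon>: "0 \<le> \<epsilon>"
    and defect: "\<And>x y. x \<in> B0 \<Longrightarrow> y \<in> B0 \<Longrightarrow>
       N0 (x - y) powr p \<le> \<epsilon> * (N0 x powr p + N0 y powr p) + C * A0.midpoint_defect p x y"
    and ab: "a \<in> sum_space" "b \<in> sum_space" and t: "0 < t" and r: "0 < r"
  shows "Kp (t / r) (a - b) \<le> (\<epsilon> + (2 / r) powr p) * (Kp t a + Kp t b)
     + C * ((Kp t a + Kp t b) / 2 - Kp t (smul (1/2) (a + b)))"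
proof (rule field_le_epsilon)
  fix e :: real assume e: "0 < e"
  \<comment> \<open>\<open>D\<close> is the coefficient with which the total cost
    \<open>X + Y\<close> enters the final bound. That cost exceeds \<open>Kp t a + Kp t b\<close> by
    at most \<open>2 * \<eta>\<close>, so \<eta> is chosen to make the excess contribute exactly
    \<open>e\<close>.\<close>
  define D where "D = \<epsilon> + (2 / r) powr p + C / 2"
  have "0 < (2 / r) powr p" using r by simp
  then have D: "0 < D" unfolding D_def using C \<epsilon> by linarith
  define \<eta> where "\<eta> = e / (2 * D)"
  have "0 < \<eta>" using e D by (simp add: \<eta>_def)
  then have "Kp t a < Kp t a + \<eta>" "Kp t b < Kp t b + \<eta>" by auto
  obtain x y where xy: "x \<in> B0" "y \<in> B1" "a = x + y"
    "N0 x powr p + (t * N1 y) powr p < Kp t a + \<eta>"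
    using Kp_approx[OF ab(1) \<open>Kp t a < Kp t a + \<eta>\<close>] .
  obtain x' y' where xy': "x' \<in> B0" "y' \<in> B1" "b = x' + y'"
    "N0 x' powr p + (t * N1 y') powr p < Kp t b + \<eta>"
    using Kp_approx[OF ab(2) \<open>Kp t b < Kp t b + \<eta>\<close>] .
  define X where "X = N0 x powr p + N0 x' powr p"
  define Y where "Y = t powr p * (N1 y powr p + N1 y' powr p)"
  have X0: "0 \<le> X" and Y0: "0 \<le> Y" by (auto simp: X_def Y_def)
  define m where "m = Kp t (smul (1/2) (a + b))"
  define Z where "Z = N0 (smul (1/2) (x + x')) powr p"
  have XY: "X + Y \<le> Kp t a + Kp t b + 2 * \<eta>"
    using xy(4) xy'(4) by (simp add: X_def Y_def powr_mult algebra_simps)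
  have y_diff: "(t / r * N1 (y - y')) powr p \<le> (2 / r) powr p * Y"
  proof -
    have "N1 (y - y') powr p \<le> (N1 y + N1 y') powr p"
      using p A1.triangle_diff[OF xy(2) xy'(2)] A1.nonneg[OF A0.subspace_diff[OF A1.sub xy(2) xy'(2)]]
      by (intro powr_mono2) auto
    also have "\<dots> \<le> 2 powr p * (N1 y powr p + N1 y' powr p)"
      using p A1.nonneg xy xy' by (intro powr_add_le) auto
    finally have "(t / r) powr p * N1 (y - y') powr p
        \<le> (t / r) powr p * (2 powr p * (N1 y powr p + N1 y' powr p))"
      by (intro mult_left_mono) auto
    then show ?thesis
      using t r by (simp add: powr_mult powr_divide Y_def field_simps)
  qed
  have "a - b = (x - x') + (y - y')"
    using xy(3) xy'(3) by simp
  then have "Kp (t / r) (a - b) \<le> N0 (x - x') powr p + (t / r * N1 (y - y')) powr p"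
    using Kp_le[OF A0.subspace_diff[OF A0.sub xy(1) xy'(1)] A0.subspace_diff[OF A1.sub xy(2) xy'(2)]]
    by (simp only:)
  also have "\<dots> \<le> \<epsilon> * X + C * (X / 2 - Z) + (2 / r) powr p * Y"
    using defect[OF xy(1) xy'(1)] y_diff by (simp add: A0.midpoint_defect_def X_def Z_def)
  \<comment> \<open>Passing to \<open>X + Y\<close> leaves only the total cost. In the defect term,
    averaging the decompositions and using convexity of the \<open>p\<close>-th power of
    \<open>N1\<close> gives \<open>m \<le> Z + Y / 2\<close>.\<close>
  also have "\<dots> \<le> \<epsilon> * (X + Y) + C * ((X + Y) / 2 - m) + (2 / r) powr p * (X + Y)"
  proof -
    have half: "smul (1/2) (x + x') \<in> B0" "smul (1/2) (y + y') \<in> B1"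
      using xy xy' by (auto intro!: A0.subspace_add A0.subspace_scale A0.sub A1.sub)
    have "smul (1/2) (a + b) = smul (1/2) (x + x') + smul (1/2) (y + y')"
      unfolding xy(3) xy'(3) by (simp only: A0.scale_right_distrib ac_simps)
    then have "m \<le> Z + t powr p * N1 (smul (1/2) (y + y')) powr p"
      using Kp_le[OF half, of t] by (simp add: m_def Z_def powr_mult)
    also have "\<dots> \<le> Z + t powr p * ((N1 y powr p + N1 y' powr p) / 2)"
      using A1.midpoint_defect_nonneg[OF xy(2) xy'(2)] p
      by (intro add_left_mono mult_left_mono) (auto simp: A1.midpoint_defect_def)
    finally have "X / 2 - Z \<le> (X + Y) / 2 - m"
      by (simp add: Y_def field_simps)
    then show ?thesis
      using C \<epsilon> X0 Y0 by (intro add_mono mult_left_mono) auto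
  qed
  also have "\<dots> = D * (X + Y) - C * m"
    by (simp add: D_def algebra_simps)
  also have "\<dots> \<le> D * (Kp t a + Kp t b + 2 * \<eta>) - C * m"
    using XY D by (intro diff_right_mono mult_left_mono) auto
  also have "\<dots> = (\<epsilon> + (2 / r) powr p) * (Kp t a + Kp t b) + C * ((Kp t a + Kp t b) / 2 - m) + e"
    using D by (simp add: D_def[symmetric] \<eta>_def ring_distribs) (simp add: D_def algebra_simps)
  finally show "Kp (t / r) (a - b) \<le> (\<epsilon> + (2 / r) powr p) * (Kp t a + Kp t b)
     + C * ((Kp t a + Kp t b) / 2 - Kp t (smul (1/2) (a + b))) + e"
    by (simp add: m_def)
qed

text \<open>A vanishing infimum yields decompositions \<open>a = x n + y n\<close> whose parts tend
  to 0 in their norms, hence in the ambient topology. The Hausdorff property then forces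
  \<open>a = 0\<close>.\<close>

lemma Kp_eq_0D:
  assumes a: "a \<in> sum_space" and t: "0 < t" and "Kp t a = 0"
  shows "a = 0"
proof -
  have "Kp t a < inverse (real (Suc n))" for n using assms by simp
  then have "\<exists>x y. x \<in> B0 \<and> y \<in> B1 \<and> a = x + y \<and> N0 x powr p + (t * N1 y) powr p < inverse (real (Suc n))" for n
    using Kp_approx[OF a] by metis
  then obtain x y where xy: "\<And>n. x n \<in> B0" "\<And>n. y n \<in> B1" "\<And>n. a = x n + y n"
    and small: "\<And>n. N0 (x n) powr p + (t * N1 (y n)) powr p < inverse (real (Suc n))"
    by metis
  have root: "u \<longlonglongrightarrow> 0" if "\<And>n. 0 \<le> u n" "\<And>n. u n powr p < inverse (real (Suc n))" for u :: "nat \<Rightarrow> real"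
  proof -
    have "(\<lambda>n. u n powr p) \<longlonglongrightarrow> 0"
      by (rule tendsto_sandwich[OF _ _ tendsto_const LIMSEQ_inverse_real_of_nat])
        (use that(2) less_imp_le in \<open>blast intro: always_eventually powr_ge_zero\<close>)+
    then have "(\<lambda>n. (u n powr p) powr (1 / p)) \<longlonglongrightarrow> 0 powr (1 / p)"
      using p by (intro tendsto_powr2 tendsto_const) auto
    then show ?thesis using that(1) p by (simp add: powr_powr)
  qed
  have small': "N0 (x n) powr p < inverse (real (Suc n))" "(t * N1 (y n)) powr p < inverse (real (Suc n))" for n
    using small[of n] powr_ge_zero[of "N0 (x n)" p] powr_ge_zero[of "t * N1 (y n)" p] by linarith+
  have "(\<lambda>n. N0 (x n)) \<longlonglongrightarrow> 0"
    by (rule root[OF A0.nonneg[OF xy(1)] small'(1)])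
  moreover have t_lim: "(\<lambda>n. t * N1 (y n)) \<longlonglongrightarrow> 0"
    by (rule root[OF _ small'(2)]) (use t A1.nonneg[OF xy(2)] in simp)
  moreover from tendsto_mult_left[OF t_lim, of "1 / t"] have "(\<lambda>n. N1 (y n)) \<longlonglongrightarrow> 0"
    using t by simp
  ultimately have "x \<longlonglongrightarrow> 0" "y \<longlonglongrightarrow> 0"
    using continuously_embedded_tendsto_zero[OF A0.complex_normed_axioms embedded0 xy(1)]
      continuously_embedded_tendsto_zero[OF A1.complex_normed_axioms embedded1 xy(2)] by auto
  then have "(\<lambda>n. x n + y n) \<longlonglongrightarrow> 0"
    using tendsto_add[of x 0 sequentially y 0] by simp
  moreover have "(\<lambda>n. x n + y n) = (\<lambda>n. a)"
    by (rule ext) (rule xy(3)[symmetric])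
  ultimately show ?thesis
    using LIMSEQ_unique[OF tendsto_const] by metis
qed


section \<open>The functional \<open>F\<close> and its comparison with the interpolation
  norm\<close>

text \<open>The exponent merges the weight \<open>(t powr (- \<theta>)) powr p\<close> with the
  density \<open>1 / t\<close>.\<close>

definition integrand :: "'v \<Rightarrow> real \<Rightarrow> real" where
  "integrand a t = indicator {0<..} t * (t powr (- \<theta> * p - 1) * Kp t a)"

text \<open>As a Bochner integral this is 0 when the integrand is not integrable, so it is
  significant only on \<open>E\<close>.\<close>

definition F :: "'v \<Rightarrow> real" where
  "F a = (LINT t|lborel. integrand a t)"

definition renorm :: "'v \<Rightarrow> real" where
  "renorm a = F a powr (1 / p)"

abbreviation K where "K \<equiv> K_functional B0 N0 B1 N1"
abbreviation E where "E \<equiv> interp_space B0 N0 B1 N1 \<theta> p"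

definition K_integrand :: "'v \<Rightarrow> real \<Rightarrow> real" where
  "K_integrand a t = indicator {0<..} t * (t powr (- \<theta> * p - 1) * K t a powr p)"

lemma K_le:
  assumes "x \<in> B0" "y \<in> B1" "0 \<le> t"
  shows "K t (x + y) \<le> N0 x + t * N1 y"
  unfolding K_functional_def using assms A0.nonneg A1.nonneg
  by (intro cInf_lower bdd_belowI[of _ 0]) auto

lemma le_K:
  assumes "a \<in> sum_space"
    and "\<And>x y. x \<in> B0 \<Longrightarrow> y \<in> B1 \<Longrightarrow> a = x + y \<Longrightarrow> c \<le> N0 x + t * N1 y"
  shows "c \<le> K t a"
  unfolding K_functional_def using assms by (intro cInf_greatest) (auto simp: sum_space_def)

lemma K_nonneg: "a \<in> sum_space \<Longrightarrow> 0 \<le> t \<Longrightarrow> 0 \<le> K t a"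
  using A0.nonneg A1.nonneg by (intro le_K) auto

lemma K_mono:
  assumes "a \<in> sum_space" "0 \<le> s" "s \<le> t"
  shows "K s a \<le> K t a"
proof (rule le_K[OF assms(1)])
  fix x y assume xy: "x \<in> B0" "y \<in> B1" "a = x + y"
  have "s * N1 y \<le> t * N1 y"
    using assms A1.nonneg[OF xy(2)] by (intro mult_right_mono) auto
  with K_le[OF xy(1,2) assms(2)] xy(3) show "K s a \<le> N0 x + t * N1 y" by simp
qed

text \<open>For a single decomposition this is superadditivity of the power. Taking
  \<open>p\<close>-th roots first allows passing to the infimum that defines
  \<open>K\<close>.\<close>

lemma Kp_le_K_powr:
  assumes a: "a \<in> sum_space" and t: "0 \<le> t"
  shows "Kp t a \<le> K t a powr p"
proof -
  have "Kp t a powr (1 / p) \<le> K t a"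
  proof (rule le_K[OF a])
    fix x y assume xy: "x \<in> B0" "y \<in> B1" "a = x + y"
    have "Kp t a \<le> (N0 x + t * N1 y) powr p"
      using Kp_le[OF xy(1,2), of t] powr_add_superadditive[of p "N0 x" "t * N1 y"]
        A0.nonneg[OF xy(1)] A1.nonneg[OF xy(2)] p t xy(3) by simp
    then have "Kp t a powr (1 / p) \<le> ((N0 x + t * N1 y) powr p) powr (1 / p)"
      using p Kp_nonneg[OF a] by (intro powr_mono2) auto
    then show "Kp t a powr (1 / p) \<le> N0 x + t * N1 y"
      using p A0.nonneg[OF xy(1)] A1.nonneg[OF xy(2)] t by (simp add: powr_powr)
  qed
  then have "(Kp t a powr (1 / p)) powr p \<le> K t a powr p"
    using p by (intro powr_mono2) auto
  then show ?thesis using p Kp_nonneg[OF a] by (simp add: powr_powr)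
qed

text \<open>Each decomposition satisfies it by \<open>powr_add_le\<close>; dividing by
  \<open>2 powr p\<close> puts the bound under the infimum that defines \<open>Kp\<close>.\<close>

lemma K_powr_le_Kp:
  assumes a: "a \<in> sum_space" and t: "0 \<le> t"
  shows "K t a powr p \<le> 2 powr p * Kp t a"
proof -
  have "K t a powr p / 2 powr p \<le> Kp t a"
  proof (rule le_Kp[OF a])
    fix x y assume xy: "x \<in> B0" "y \<in> B1" "a = x + y"
    have "K t a powr p \<le> (N0 x + t * N1 y) powr p"
      using K_le[OF xy(1,2) t] K_nonneg[OF a t] xy(3) p by (intro powr_mono2) auto
    also have "\<dots> \<le> 2 powr p * (N0 x powr p + (t * N1 y) powr p)"
      using p t A0.nonneg[OF xy(1)] A1.nonneg[OF xy(2)] by (intro powr_add_le) auto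
    finally show "K t a powr p / 2 powr p \<le> N0 x powr p + (t * N1 y) powr p"
      by (simp add: field_simps)
  qed
  then show ?thesis by (simp add: field_simps)
qed

lemma integrand_measurable: "a \<in> sum_space \<Longrightarrow> integrand a \<in> borel_measurable lborel"
  unfolding integrand_def[abs_def] by (intro weighted_mono_measurable Kp_mono)

lemma K_integrand_measurable: "a \<in> sum_space \<Longrightarrow> K_integrand a \<in> borel_measurable lborel"
  unfolding K_integrand_def[abs_def] using p
  by (intro weighted_mono_measurable powr_mono2 K_mono K_nonneg) auto

lemma integrand_nonneg: "a \<in> sum_space \<Longrightarrow> 0 \<le> integrand a t"
  by (auto simp: integrand_def indicator_def Kp_nonneg)

lemma K_integrand_nonneg: "0 \<le> K_integrand a t"
  by (auto simp: K_integrand_def indicator_def)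

lemma integrand_le_K_integrand: "a \<in> sum_space \<Longrightarrow> integrand a t \<le> K_integrand a t"
  by (auto simp: integrand_def K_integrand_def indicator_def intro!: mult_left_mono Kp_le_K_powr)

lemma K_integrand_le_integrand:
  assumes "a \<in> sum_space"
  shows "K_integrand a t \<le> 2 powr p * integrand a t"
proof (cases "0 < t")
  case True
  then have "t powr (- \<theta> * p - 1) * K t a powr p \<le> t powr (- \<theta> * p - 1) * (2 powr p * Kp t a)"
    using assms by (intro mult_left_mono K_powr_le_Kp) auto
  then show ?thesis
    using True by (simp add: integrand_def K_integrand_def mult.left_commute)
qed (simp add: integrand_def K_integrand_def)

lemma interp_integral_eq:
  assumes "a \<in> sum_space"
  shows "interp_integral B0 N0 B1 N1 \<theta> p a = (\<integral>\<^sup>+t. ennreal (K_integrand a t) \<partial>lborel)"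
  unfolding interp_integral_def
proof (intro nn_integral_cong)
  fix t :: real
  show "ennreal ((t powr - \<theta> * K t a) powr p / t) * indicator {0<..} t = ennreal (K_integrand a t)"
  proof (cases "0 < t")
    case True
    then show ?thesis
      by (simp add: K_integrand_def powr_mult powr_powr powr_diff)
  qed (simp add: K_integrand_def)
qed

lemma integrable_integrand_iff:
  assumes "a \<in> sum_space"
  shows "integrable lborel (integrand a) \<longleftrightarrow> integrable lborel (K_integrand a)"
proof
  assume "integrable lborel (integrand a)"
  then have "integrable lborel (\<lambda>t. 2 powr p * integrand a t)" by simp
  then show "integrable lborel (K_integrand a)"
    by (rule Bochner_Integration.integrable_bound[OF _ K_integrand_measurable[OF assms]])
      (use assms in \<open>simp add: K_integrand_nonneg integrand_nonneg K_integrand_le_integrand\<close>)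
next
  assume "integrable lborel (K_integrand a)"
  then show "integrable lborel (integrand a)"
    by (rule Bochner_Integration.integrable_bound[OF _ integrand_measurable[OF assms]])
      (use assms in \<open>simp add: K_integrand_nonneg integrand_nonneg integrand_le_K_integrand\<close>)
qed

text \<open>For a nonnegative measurable function a finite integral means integrability, and the two
  integrands bound each other up to the factor \<open>2 powr p\<close>.\<close>

lemma in_E_iff: "a \<in> E \<longleftrightarrow> a \<in> sum_space \<and> integrable lborel (integrand a)"
proof -
  have "integrable lborel (K_integrand a) \<longleftrightarrow> interp_integral B0 N0 B1 N1 \<theta> p a < \<infinity>" if "a \<in> sum_space"
    using that K_integrand_measurable[OF that]
    by (simp add: interp_integral_eq integrable_iff_bounded K_integrand_nonneg)
  then show ?thesis
    using integrable_integrand_iff by (auto simp: interp_space_def sum_space_def)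
qed

lemma E_sum_space: "a \<in> E \<Longrightarrow> a \<in> sum_space"
  by (simp add: in_E_iff)

lemma E_integrable: "a \<in> E \<Longrightarrow> integrable lborel (integrand a)"
  by (simp add: in_E_iff)

lemma F_nonneg: "a \<in> sum_space \<Longrightarrow> 0 \<le> F a"
  unfolding F_def by (simp add: integrand_nonneg)

text \<open>The pointwise comparison of the integrands has constants 1 and \<open>2 powr p\<close>;
  integration and a \<open>p\<close>-th root turn them into 1 and 2.\<close>

lemma renorm_bounds:
  assumes a: "a \<in> E"
  shows "renorm a \<le> interp_norm B0 N0 B1 N1 \<theta> p a"
    and "interp_norm B0 N0 B1 N1 \<theta> p a \<le> 2 * renorm a"
proof -
  note S = E_sum_space[OF a]
  have K_int: "integrable lborel (K_integrand a)"
    using E_integrable[OF a] integrable_integrand_iff[OF S] by simp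
  have eq: "interp_norm B0 N0 B1 N1 \<theta> p a = (LINT t|lborel. K_integrand a t) powr (1 / p)"
    unfolding interp_norm_def interp_integral_eq[OF S]
    by (subst integral_eq_nn_integral[OF K_integrand_measurable[OF S]]) (auto simp: K_integrand_nonneg)
  have "F a \<le> (LINT t|lborel. K_integrand a t)"
    unfolding F_def by (intro integral_mono E_integrable a K_int integrand_le_K_integrand S)
  then show "renorm a \<le> interp_norm B0 N0 B1 N1 \<theta> p a"
    unfolding eq renorm_def using p F_nonneg[OF S] by (intro powr_mono2) auto
  have "(LINT t|lborel. K_integrand a t) \<le> (LINT t|lborel. 2 powr p * integrand a t)"
    by (intro integral_mono K_int K_integrand_le_integrand S)
      (use E_integrable[OF a] in simp)
  then have "(LINT t|lborel. K_integrand a t) \<le> 2 powr p * F a"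
    by (simp add: F_def)
  then have "(LINT t|lborel. K_integrand a t) powr (1 / p) \<le> (2 powr p * F a) powr (1 / p)"
    using p by (intro powr_mono2) (auto simp: K_integrand_nonneg)
  then show "interp_norm B0 N0 B1 N1 \<theta> p a \<le> 2 * renorm a"
    unfolding eq renorm_def using p by (simp add: powr_mult powr_powr)
qed

section \<open>The norm \<open>renorm\<close> on the interpolation space\<close>

lemma integrand_scale:
  "a \<in> sum_space \<Longrightarrow> integrand (smul c a) t = cmod c powr p * integrand a t"
  by (simp add: integrand_def Kp_scale)

lemma E_scale:
  assumes "a \<in> E"
  shows "smul c a \<in> E"
proof -
  have "integrand (smul c a) = (\<lambda>t. cmod c powr p * integrand a t)"
    using integrand_scale[OF E_sum_space[OF assms]] by (rule ext)
  then show ?thesis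
    using assms by (simp add: in_E_iff sum_space_scale)
qed

lemma F_scale: "a \<in> sum_space \<Longrightarrow> F (smul c a) = cmod c powr p * F a"
  by (simp add: F_def integrand_scale)

lemma integrand_convex_comb:
  assumes "a \<in> sum_space" "b \<in> sum_space" "0 \<le> s" "s \<le> 1"
  shows "integrand (smul (of_real s) a + smul (of_real (1 - s)) b) t
    \<le> s * integrand a t + (1 - s) * integrand b t"
proof (cases "0 < t")
  case True
  have "t powr (- \<theta> * p - 1) * Kp t (smul (of_real s) a + smul (of_real (1 - s)) b)
      \<le> t powr (- \<theta> * p - 1) * (s * Kp t a + (1 - s) * Kp t b)"
    using assms True by (intro mult_left_mono Kp_convex_comb) auto
  then show ?thesis
    using True by (simp add: integrand_def algebra_simps)
qed (simp add: integrand_def)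

lemma E_convex_comb:
  assumes ab: "a \<in> E" "b \<in> E" and s: "0 \<le> s" "s \<le> 1"
  shows "smul (of_real s) a + smul (of_real (1 - s)) b \<in> E"
proof -
  let ?c = "smul (of_real s) a + smul (of_real (1 - s)) b"
  note S = ab[THEN E_sum_space]
  have c: "?c \<in> sum_space"
    by (intro sum_space_add sum_space_scale S)
  have "integrable lborel (\<lambda>t. s * integrand a t + (1 - s) * integrand b t)"
    using ab[THEN E_integrable] by simp
  then have "integrable lborel (integrand ?c)"
  proof (rule Bochner_Integration.integrable_bound[OF _ integrand_measurable[OF c]], intro AE_I2)
    fix t
    show "norm (integrand ?c t) \<le> norm (s * integrand a t + (1 - s) * integrand b t)"
      using integrand_convex_comb[OF S s, of t] integrand_nonneg[OF c, of t] by simp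
  qed
  with c show ?thesis by (simp add: in_E_iff)
qed

lemma F_convex_comb:
  assumes ab: "a \<in> E" "b \<in> E" and s: "0 \<le> s" "s \<le> 1"
  shows "F (smul (of_real s) a + smul (of_real (1 - s)) b) \<le> s * F a + (1 - s) * F b"
proof -
  let ?c = "smul (of_real s) a + smul (of_real (1 - s)) b"
  have "F ?c \<le> (LINT t|lborel. s * integrand a t + (1 - s) * integrand b t)"
    unfolding F_def using ab[THEN E_integrable] ab[THEN E_sum_space] s
    by (intro integral_mono integrand_convex_comb E_integrable E_convex_comb ab) auto
  also have "\<dots> = s * F a + (1 - s) * F b"
    using ab[THEN E_integrable] by (simp add: F_def)
  finally show ?thesis .
qed

lemma E_subspace: "A0.subspace E"
proof (rule A0.subspaceI)
  have "integrand 0 = (\<lambda>t. 0)"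
    using integrand_scale[OF zero_in_sum_space, of 0] by (simp add: fun_eq_iff)
  then show "0 \<in> E"
    by (simp add: in_E_iff zero_in_sum_space)
next
  fix a b assume "a \<in> E" "b \<in> E"
  \<comment> \<open>A sum is twice a midpoint, so closure under convex combinations and scaling
    suffices.\<close>
  then have "smul 2 (smul (of_real (1/2)) a + smul (of_real (1 - 1/2)) b) \<in> E"
    by (intro E_scale E_convex_comb) auto
  then show "a + b \<in> E"
    by (simp add: A0.scale_right_distrib)
qed (rule E_scale)

text \<open>If \<open>a\<close> is nonzero, \<open>Kp t a\<close> is nonzero for every positive
  \<open>t\<close>. A vanishing integral would then make the half-line a null set.\<close>

lemma F_eq_0D:
  assumes a: "a \<in> E" and "F a = 0"
  shows "a = 0"
proof (rule ccontr)
  assume "a \<noteq> 0"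
  have "AE t in lborel. integrand a t = 0"
    using assms integral_nonneg_eq_0_iff_AE[OF E_integrable[OF a]] integrand_nonneg[OF E_sum_space[OF a]]
    by (simp add: F_def)
  then have "AE t in lborel. t \<notin> {0::real<..}"
  proof eventually_elim
    case (elim t)
    with \<open>a \<noteq> 0\<close> Kp_eq_0D[OF E_sum_space[OF a], of t] show ?case
      by (auto simp: integrand_def)
  qed
  then have null: "{0::real<..} \<in> null_sets lborel"
    by (simp add: AE_iff_null_sets)
  have "{0::real<..<1} \<in> null_sets lborel"
    by (rule null_sets_subset[OF null]) auto
  then show False by (simp add: null_sets_def)
qed

text \<open>For the triangle inequality, the unit ball is the sublevel set \<open>F \<le> 1\<close>,
  which is convex because \<open>F\<close> is; homogeneity reduces the general case to it.\<close>

lemma norm_on_renorm: "norm_on smul E renorm"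
proof -
  have zero: "renorm a = 0 \<longleftrightarrow> a = 0" if "a \<in> E" for a
    using F_eq_0D[OF that] F_scale[OF zero_in_sum_space, of 0] by (auto simp: renorm_def)
  have scale: "renorm (smul c a) = cmod c * renorm a" if "a \<in> E" for c a
    using F_scale[OF E_sum_space[OF that], of c] p by (simp add: renorm_def powr_mult powr_powr)
  have tri: "renorm (a + b) \<le> renorm a + renorm b" if ab: "a \<in> E" "b \<in> E" for a b
  proof (cases "a = 0 \<or> b = 0")
    case True
    then show ?thesis by (auto simp: renorm_def)
  next
    case False
    define \<alpha> where "\<alpha> = renorm a"
    define \<beta> where "\<beta> = renorm b"
    have "\<alpha> \<noteq> 0" "\<beta> \<noteq> 0" using zero ab False by (auto simp: \<alpha>_def \<beta>_def)
    then have pos: "0 < \<alpha>" "0 < \<beta>" by (auto simp: \<alpha>_def \<beta>_def renorm_def)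
    define a' where "a' = smul (of_real (1 / \<alpha>)) a"
    define b' where "b' = smul (of_real (1 / \<beta>)) b"
    have in_E: "a' \<in> E" "b' \<in> E"
      unfolding a'_def b'_def by (intro E_scale ab)+
    have F1: "F c = 1" if "c \<in> E" "renorm c = 1" for c
    proof -
      have "(F c powr (1 / p)) powr p = 1" using that(2) by (simp add: renorm_def)
      then show ?thesis using p F_nonneg[OF E_sum_space[OF that(1)]] by (simp add: powr_powr)
    qed
    have "renorm a' = 1" "renorm b' = 1"
      unfolding a'_def b'_def scale[OF ab(1)] scale[OF ab(2)] norm_of_real \<alpha>_def[symmetric] \<beta>_def[symmetric]
      using pos by simp_all
    then have F_ab: "F a' = 1" "F b' = 1"
      by (auto intro!: F1 in_E)
    \<comment> \<open>With this weight the convex combination of the two unit vectors is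
      \<open>a + b\<close> divided by \<open>\<alpha> + \<beta>\<close>.\<close>
    define s where "s = \<alpha> / (\<alpha> + \<beta>)"
    have s: "0 \<le> s" "s \<le> 1" using pos by (auto simp: s_def)
    define c where "c = smul (of_real s) a' + smul (of_real (1 - s)) b'"
    have c: "c \<in> E"
      unfolding c_def by (intro E_convex_comb in_E s)
    have "F c \<le> 1"
      using F_convex_comb[OF in_E s, folded c_def] by (simp add: F_ab)
    then have "F c powr (1 / p) \<le> 1 powr (1 / p)"
      using p F_nonneg[OF E_sum_space[OF c]] by (intro powr_mono2) auto
    then have renorm_c: "renorm c \<le> 1"
      by (simp add: renorm_def)
    have "1 - s = \<beta> / (\<alpha> + \<beta>)"
      using pos by (simp add: s_def field_simps)
    then have "(\<alpha> + \<beta>) * (s * (1 / \<alpha>)) = 1" "(\<alpha> + \<beta>) * ((1 - s) * (1 / \<beta>)) = 1"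
      using pos by (simp_all add: s_def)
    then have "smul (of_real (\<alpha> + \<beta>)) c = a + b"
      unfolding c_def a'_def b'_def A0.scale_right_distrib A0.scale_scale of_real_mult[symmetric]
      by (simp only: of_real_1 A0.scale_one)
    then have "renorm (a + b) = \<bar>\<alpha> + \<beta>\<bar> * renorm c"
      using scale[OF c, of "of_real (\<alpha> + \<beta>)"] by (simp only: norm_of_real)
    also have "\<dots> \<le> \<alpha> + \<beta>"
      using pos mult_left_mono[OF renorm_c, of "\<alpha> + \<beta>"] by simp
    finally show ?thesis by (simp only: \<alpha>_def \<beta>_def)
  qed
  have "0 \<le> renorm a" for a
    by (simp add: renorm_def)
  then show ?thesis
    unfolding norm_on_def by (intro conjI ballI allI E_subspace zero scale tri)
qed

section \<open>Uniform convexity of \<open>F\<close>\<close>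

text \<open>Integrate \<open>Kp_diff_le\<close> over \<open>t\<close>. In the substitution
  \<open>t / r\<close> the weight contributes \<open>r powr (\<theta> * p + 1)\<close> and the
  change of variable \<open>1 / r\<close>, leaving \<open>r powr (\<theta> * p)\<close>.\<close>

lemma F_diff_le:
  assumes C: "0 \<le> C" and \<epsilon>: "0 \<le> \<epsilon>"
    and defect: "\<And>x y. x \<in> B0 \<Longrightarrow> y \<in> B0 \<Longrightarrow>
       N0 (x - y) powr p \<le> \<epsilon> * (N0 x powr p + N0 y powr p) + C * A0.midpoint_defect p x y"
    and ab: "a \<in> E" "b \<in> E" and r: "0 < r"
  shows "F (a - b) \<le> r powr (\<theta> * p) * ((\<epsilon> + (2 / r) powr p) * (F a + F b)
     + C * ((F a + F b) / 2 - F (smul (1/2) (a + b))))"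
proof -
  let ?m = "smul (1/2) (a + b)"
  let ?R = "\<lambda>t. r powr (\<theta> * p + 1) * ((\<epsilon> + (2 / r) powr p) * (integrand a t + integrand b t)
     + C * ((integrand a t + integrand b t) / 2 - integrand ?m t))"
  note S = ab[THEN E_sum_space]
  have m: "?m \<in> E" and d: "a - b \<in> E"
    by (intro A0.subspace_scale A0.subspace_add A0.subspace_diff E_subspace ab)+
  note int = ab[THEN E_integrable] E_integrable[OF m]
  \<comment> \<open>The argument is written as an affine map to match
    \<open>lborel_integral_real_affine\<close>.\<close>
  have "integrand (a - b) (0 + 1 / r * t) \<le> ?R t" for t
  proof (cases "0 < t")
    case True
    have "(t / r) powr (- \<theta> * p - 1) = t powr (- \<theta> * p - 1) / r powr (- (\<theta> * p + 1))"
      using True r by (simp add: powr_divide)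
    then have "(t / r) powr (- \<theta> * p - 1) = r powr (\<theta> * p + 1) * t powr (- \<theta> * p - 1)"
      unfolding powr_minus_divide[of r] by simp
    then have "integrand (a - b) (0 + 1 / r * t)
        = r powr (\<theta> * p + 1) * (t powr (- \<theta> * p - 1) * Kp (t / r) (a - b))"
      using True r by (simp add: integrand_def)
    also have "\<dots> \<le> r powr (\<theta> * p + 1) * (t powr (- \<theta> * p - 1) *
        ((\<epsilon> + (2 / r) powr p) * (Kp t a + Kp t b) + C * ((Kp t a + Kp t b) / 2 - Kp t ?m)))"
      by (intro mult_left_mono Kp_diff_le C \<epsilon> defect S True r) auto
    also have "\<dots> = ?R t"
    proof -
      have "integrand c t = t powr (- \<theta> * p - 1) * Kp t c" for c
        using True by (simp add: integrand_def)
      moreover define w where "w = t powr (- \<theta> * p - 1)"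
      ultimately have "integrand c t = w * Kp t c" for c by simp
      then show ?thesis
        unfolding w_def[symmetric] by (simp add: algebra_simps add_divide_distrib)
    qed
    finally show ?thesis .
  next
    case False
    with r have "\<not> 0 < 0 + 1 / r * t"
      by (simp add: field_simps)
    with False show ?thesis by (simp add: integrand_def)
  qed
  then have "(LINT t|lborel. integrand (a - b) (0 + 1 / r * t)) \<le> (LINT t|lborel. ?R t)"
    using r int by (intro integral_mono lborel_integrable_real_affine E_integrable d) auto
  also have "\<dots> = r powr (\<theta> * p + 1) * ((\<epsilon> + (2 / r) powr p) * (F a + F b)
     + C * ((F a + F b) / 2 - F ?m))"
    using int by (simp add: F_def)
  finally have "(1 / r) * (LINT t|lborel. integrand (a - b) (0 + 1 / r * t)) \<le> (1 / r) * \<dots>"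
    using r by (intro mult_left_mono) auto
  moreover have "F (a - b) = (1 / r) * (LINT t|lborel. integrand (a - b) (0 + 1 / r * t))"
    unfolding F_def using r by (subst lborel_integral_real_affine[of "1 / r" _ 0]) auto
  ultimately show ?thesis
    using r by (simp add: powr_add)
qed

text \<open>In \<open>F_diff_le\<close> the \<open>B1\<close>-part has coefficient
  \<open>2 powr p * r powr (- ((1 - \<theta>) * p))\<close>, which tends to 0 as \<open>r\<close>
  grows because \<open>\<theta> < 1\<close>.\<close>

lemma F_uniform_convexity:
  assumes ur: "uniformly_rotund B0 N0" and \<delta>: "0 < \<delta>"
  obtains C where "0 \<le> C"
    "\<And>a b. a \<in> E \<Longrightarrow> b \<in> E \<Longrightarrow>
       F (a - b) \<le> \<delta> * (F a + F b) + C * ((F a + F b) / 2 - F (smul (1/2) (a + b)))"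
proof -
  have "((\<lambda>r::real. 2 powr p * r powr (- ((1 - \<theta>) * p))) \<longlongrightarrow> 2 powr p * 0) at_top"
    using \<theta> p by (intro tendsto_mult tendsto_const tendsto_neg_powr filterlim_ident) auto
  from order_tendstoD(2)[OF this, of "\<delta> / 2"]
  have "\<forall>\<^sub>F r::real in at_top. 2 powr p * r powr (- ((1 - \<theta>) * p)) < \<delta> / 2"
    using \<delta> by simp
  then have "\<forall>\<^sub>F r::real in at_top. 0 < r \<and> 2 powr p * r powr (- ((1 - \<theta>) * p)) < \<delta> / 2"
    using eventually_gt_at_top[of "0::real"] by eventually_elim simp
  then obtain r :: real where r: "0 < r" "2 powr p * r powr (- ((1 - \<theta>) * p)) < \<delta> / 2"
    using eventually_happens[of _ "at_top :: real filter"] by auto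
  \<comment> \<open>With \<open>r\<close> fixed, this choice makes the other coefficient equal to
    \<open>\<delta> / 2\<close>; the constant \<open>C\<close> for the norm on \<open>B0\<close>
    comes last.\<close>
  define \<epsilon> where "\<epsilon> = \<delta> / 2 / r powr (\<theta> * p)"
  have \<epsilon>: "0 < \<epsilon>" using r \<delta> by (simp add: \<epsilon>_def)
  obtain C where C: "0 \<le> C" "\<And>x y. x \<in> B0 \<Longrightarrow> y \<in> B0 \<Longrightarrow>
       N0 (x - y) powr p \<le> \<epsilon> * (N0 x powr p + N0 y powr p) + C * A0.midpoint_defect p x y"
    using A0.uniformly_rotund_powr_diff_le[OF ur p \<epsilon>] by blast
  have "r powr (\<theta> * p) * (2 / r) powr p = 2 powr p * r powr (- ((1 - \<theta>) * p))"
  proof -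
    have "r powr (- ((1 - \<theta>) * p)) = r powr (\<theta> * p) / r powr p"
      by (simp add: left_diff_distrib powr_diff)
    then show ?thesis using r by (simp add: powr_divide)
  qed
  moreover have "r powr (\<theta> * p) * \<epsilon> = \<delta> / 2"
    using r by (simp add: \<epsilon>_def)
  ultimately have coeff: "r powr (\<theta> * p) * (\<epsilon> + (2 / r) powr p) \<le> \<delta>"
    using r(2) by (simp add: distrib_left)
  show thesis
  proof
    show "0 \<le> r powr (\<theta> * p) * C" using C(1) by simp
    fix a b assume ab: "a \<in> E" "b \<in> E"
    have "F (a - b) \<le> r powr (\<theta> * p) * ((\<epsilon> + (2 / r) powr p) * (F a + F b)
       + C * ((F a + F b) / 2 - F (smul (1/2) (a + b))))"
      using \<epsilon> by (intro F_diff_le C ab r) auto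
    also have "\<dots> = (r powr (\<theta> * p) * (\<epsilon> + (2 / r) powr p)) * (F a + F b)
       + r powr (\<theta> * p) * C * ((F a + F b) / 2 - F (smul (1/2) (a + b)))"
      by (simp only: distrib_left[of "r powr (\<theta> * p)" "_ * _"] mult.assoc)
    also have "\<dots> \<le> \<delta> * (F a + F b) + r powr (\<theta> * p) * C * ((F a + F b) / 2 - F (smul (1/2) (a + b)))"
      using coeff F_nonneg ab[THEN E_sum_space] by (intro add_right_mono mult_right_mono) auto
    finally show "F (a - b) \<le> \<delta> * (F a + F b)
       + r powr (\<theta> * p) * C * ((F a + F b) / 2 - F (smul (1/2) (a + b)))" .
  qed
qed

section \<open>Uniform rotundity of \<open>renorm\<close> and the theorem\<close>

lemma uniformly_rotund_renorm:
  assumes ur: "uniformly_rotund B0 N0"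
  shows "uniformly_rotund E renorm"
  unfolding uniformly_rotund_def
proof (intro allI impI)
  fix x y :: "nat \<Rightarrow> 'v"
  assume *: "(\<forall>n. x n \<in> E \<and> renorm (x n) = 1) \<and> (\<forall>n. y n \<in> E \<and> renorm (y n) = 1) \<and>
    (\<lambda>n. renorm (x n + y n)) \<longlonglongrightarrow> 2"
  then have E: "x n \<in> E" "y n \<in> E" and lim: "(\<lambda>n. renorm (x n + y n)) \<longlonglongrightarrow> 2" for n by auto
  have F_eq: "F a = renorm a powr p" if "a \<in> E" for a
    using p F_nonneg[OF E_sum_space[OF that]] by (simp add: renorm_def powr_powr)
  have F1: "F (x n) = 1" "F (y n) = 1" for n
    using * by (simp_all add: F_eq)
  have d: "x n - y n \<in> E" and s: "x n + y n \<in> E" for n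
    by (intro A0.subspace_add A0.subspace_diff E_subspace E)+
  have "(\<lambda>n. (1/2) powr p * renorm (x n + y n) powr p) \<longlonglongrightarrow> (1/2) powr p * 2 powr p"
    by (intro tendsto_intros lim) auto
  then have mid: "(\<lambda>n. F (smul (1/2) (x n + y n))) \<longlonglongrightarrow> 1"
    using F_scale[OF E_sum_space[OF s], of "1/2"] F_eq[OF s] by (simp flip: powr_mult)
  have "(\<lambda>n. F (x n - y n)) \<longlonglongrightarrow> 0"
  proof (rule order_tendstoI)
    fix e :: real assume e: "0 < e"
    obtain C where C: "0 \<le> C" "\<And>a b. a \<in> E \<Longrightarrow> b \<in> E \<Longrightarrow>
       F (a - b) \<le> e / 4 * (F a + F b) + C * ((F a + F b) / 2 - F (smul (1/2) (a + b)))"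
      using F_uniform_convexity[OF ur, of "e / 4"] e by auto
    \<comment> \<open>\<open>F\<close> is 1 at both unit vectors and tends to 1 at their midpoint,
      so the defect term vanishes and the bound tends to \<open>e / 2\<close>, strictly below
      \<open>e\<close>.\<close>
    have "(\<lambda>n. e / 4 * (1 + 1) + C * ((1 + 1) / 2 - F (smul (1/2) (x n + y n))))
        \<longlonglongrightarrow> e / 4 * (1 + 1) + C * ((1 + 1) / 2 - 1)"
      by (intro tendsto_intros mid)
    from order_tendstoD(2)[OF this, of e]
    have "\<forall>\<^sub>F n in sequentially. e / 4 * (1 + 1) + C * ((1 + 1) / 2 - F (smul (1/2) (x n + y n))) < e"
      using e by simp
    then show "\<forall>\<^sub>F n in sequentially. F (x n - y n) < e"
    proof eventually_elim
      case (elim n)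
      with C(2)[OF E, of n n] show ?case by (simp add: F1)
    qed
  next
    fix e :: real assume "e < 0"
    then show "\<forall>\<^sub>F n in sequentially. e < F (x n - y n)"
      using F_nonneg[OF E_sum_space[OF d]] by (auto intro!: always_eventually intro: less_le_trans)
  qed
  then have "(\<lambda>n. F (x n - y n) powr (1 / p)) \<longlonglongrightarrow> 0 powr (1 / p)"
    using p F_nonneg[OF E_sum_space[OF d]] by (intro tendsto_powr2 tendsto_const) auto
  then show "(\<lambda>n. renorm (x n - y n)) \<longlonglongrightarrow> 0"
    by (simp add: renorm_def)
qed

lemma equivalent_on_renorm: "equivalent_on E (interp_norm B0 N0 B1 N1 \<theta> p) renorm"
  unfolding equivalent_on_def
proof (intro exI conjI ballI)
  fix a assume "a \<in> E"
  from renorm_bounds[OF this]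
  show "1/2 * interp_norm B0 N0 B1 N1 \<theta> p a \<le> renorm a"
    and "renorm a \<le> 1 * interp_norm B0 N0 B1 N1 \<theta> p a" by auto
qed auto

end

theorem theorem8p1:
  fixes smul :: "complex \<Rightarrow> 'v \<Rightarrow> 'v::{topological_ab_group_add, t2_space}"
    and B0 B1 :: "'v set" and N0 N1 :: "'v \<Rightarrow> real" and \<theta> p :: real
  assumes "interpolation_couple smul B0 N0 B1 N1"
    and "0 < \<theta>" and "\<theta> < 1" and "1 < p"
    and "uniformly_rotund B0 N0"
  shows "\<exists>M. norm_on smul (interp_space B0 N0 B1 N1 \<theta> p) M \<and>
             equivalent_on (interp_space B0 N0 B1 N1 \<theta> p) (interp_norm B0 N0 B1 N1 \<theta> p) M \<and>
             uniformly_rotund (interp_space B0 N0 B1 N1 \<theta> p) M"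
proof -
  have "complex_normed smul B0 N0" "complex_normed smul B1 N1"
    using assms(1)
    by (auto simp: interpolation_couple_def hausdorff_complex_tvs_def banach_on_def
        complex_normed_def complex_normed_axioms_def)
  then interpret interpolation smul B0 N0 B1 N1 \<theta> p
    using assms by (simp add: interpolation_def interpolation_axioms_def interpolation_couple_def)
  show ?thesis
    using norm_on_renorm equivalent_on_renorm uniformly_rotund_renorm[OF assms(5)] by blast
qed

end
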